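(* The function $F$ is infinitely differentiable at every $\alpha>0$. For each $k\ge1$, its derivatives $F^{(2k)}(\alpha)$ and $F^{(2k+1)}(\alpha)$ are given in terms of the $k$-th derivative $x_\alpha^{(k)}$ by \[ F^{(2k)}(\alpha)=C_k\big((K^*K+\alpha B)x_\alpha^{(k)},x_\alpha^{(k)}\big)_X,\qquad F^{(2k+1)}(\alpha)=-C_k(1+2k)\big(Bx_\alpha^{(k)},x_\alpha^{(k)}\big)_X , \] where the constants $C_k$ are defined recursively by $C_1=-2$ and $C_{k+1}=\dfrac{2(2k+1)}{k+1}\,C_k$.
   Context: Let $X,Y$ be (real) Hilbert spaces, $K:X\to Y$ a bounded linear operator with adjoint $K^*$, $B:X\to X$ a bounded linear self-adjoint nonnegative operator, and $y^\delta\in Y$. For $\alpha>0$ consider, with no constraint ($Q_{\mathrm{ad}}=X$), the functional $J_\alpha(x)=\|Kx-y^\delta\|_Y^2+\alpha(Bx,x)_X$ on $X$. It is assumed that $B$ is such that for every $\alpha>0$ (and every datum $y^\delta\in Y$) $J_\alpha$ has a unique minimizer $x_\alpha\in X$; it is given by $x_\alpha=(K^*K+\alpha B)^{-1}K^*y^\delta$. Define $F(\alpha)=\inf_{x\in X}J_\alpha(x)=J_\alpha(x_\alpha)$. The map $\alpha\mapsto x_\alpha$ is infinitely differentiable on $(0,\infty)$ with values in $X$ (a known result of Kunisch and Zou), and $x_\alpha^{(k)}$ denotes its $k$-th derivative with respect to $\alpha$. *)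

theory Defs
  imports "HOL-Analysis.Analysis"
begin

text \<open>Real Hilbert spaces are types of sort \<open>{real_inner, complete_space}\<close>.\<close>

definition tikhonov ::
  "('x::real_inner \<Rightarrow> 'y::real_inner) \<Rightarrow> ('x \<Rightarrow> 'x) \<Rightarrow> 'y \<Rightarrow> real \<Rightarrow> 'x \<Rightarrow> real"
  where "tikhonov K B y \<alpha> x = (norm (K x - y))\<^sup>2 + \<alpha> * (B x \<bullet> x)"

definition tikhonov_min ::
  "('x::real_inner \<Rightarrow> 'y::real_inner) \<Rightarrow> ('x \<Rightarrow> 'x) \<Rightarrow> 'y \<Rightarrow> real \<Rightarrow> 'x"
  where "tikhonov_min K B y \<alpha> = arg_min (tikhonov K B y \<alpha>) (\<lambda>_. True)"

definition value_fun ::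
  "('x::real_inner \<Rightarrow> 'y::real_inner) \<Rightarrow> ('x \<Rightarrow> 'x) \<Rightarrow> 'y \<Rightarrow> real \<Rightarrow> real"
  where "value_fun K B y \<alpha> = (INF x. tikhonov K B y \<alpha> x)"

text \<open>The \<open>k\<close>-th derivative of a curve, by iterating the derivative of the library.
  Like \<^const>\<open>deriv\<close>, \<^const>\<open>vector_derivative\<close> is total, so this is the actual \<open>k\<close>-th
  derivative only where the curve is \<open>k\<close> times differentiable.\<close>

definition higher_vector_derivative ::
  "nat \<Rightarrow> (real \<Rightarrow> 'x::real_normed_vector) \<Rightarrow> real \<Rightarrow> 'x"
  where "higher_vector_derivative k f =
    ((\<lambda>g t. vector_derivative g (at t)) ^^ k) f"

text \<open>The recursion starts at index 1; the value at 0 is a dummy.\<close>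

fun C :: "nat \<Rightarrow> real" where
  "C 0 = 0"
| "C (Suc 0) = - 2"
| "C (Suc (Suc k)) = 2 * (2 * real (Suc k) + 1) / (real (Suc k) + 1) * C (Suc k)"

end

theory Submission
  imports Defs
begin

text \<open>
  The functional is quadratic, so \<open>x\<close> minimizes it for the parameter \<open>\<alpha>\<close> and the datum \<open>y\<close> exactly
  when \<open>\<langle>K x, K v\<rangle> + \<alpha> \<langle>B x, v\<rangle> = \<langle>y, K v\<rangle>\<close> for all \<open>v\<close>.  Write \<open>S\<^sub>\<alpha> y\<close> for this minimizer and
  \<open>T\<^sub>\<alpha> y = (y - K S\<^sub>\<alpha> y) / \<alpha>\<close> for the scaled residual.  The equation then reads
  \<open>\<langle>B S\<^sub>\<alpha> y, v\<rangle> = \<langle>T\<^sub>\<alpha> y, K v\<rangle>\<close>: on minimizers, \<open>B\<close> takes values in the range of the adjoint of \<open>K\<close>.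
  Hence the perturbation caused by a change of \<open>\<alpha>\<close> is again the right-hand side of a normal
  equation, although \<open>K\<^sup>* K + \<alpha> B\<close> may fail to be onto.  This gives the
  resolvent identities (\<open>sol_resolvent\<close>, \<open>res_resolvent\<close>)
  \<open>S\<^sub>\<beta> - S\<^sub>\<alpha> = - (\<beta> - \<alpha>) S\<^sub>\<alpha> T\<^sub>\<beta>\<close> and \<open>T\<^sub>\<beta> - T\<^sub>\<alpha> = - (\<beta> - \<alpha>) T\<^sub>\<alpha> T\<^sub>\<beta>\<close>.

  Both identities can be differentiated at \<open>\<beta> = \<alpha>\<close>, because \<open>T\<^sub>\<beta>\<close> has norm at most \<open>1/\<beta>\<close> and \<open>S\<^sub>\<alpha>\<close> is
  bounded.  Without coercivity the latter is not an estimate that can be read off the equation; it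
  follows from the closed graph theorem, since the equation survives limits in \<open>x\<close> and \<open>y\<close>.  So
  \<open>T' = - T\<^sup>2\<close> and \<open>S' = - S T\<close>, and induction yields \<open>(S T^k)' = - (k + 1) S T^(k + 1)\<close>.
  Therefore the minimizer \<open>x\<close> has the derivatives \<open>x\<^sub>k = (- 1)^k k! S T^k y\<close>
  (\<open>higher_derivative_sol\<close>).

  The minimal value is \<open>F(\<alpha>) = \<langle>y, y - K S\<^sub>\<alpha> y\<rangle> = \<alpha> m(1)\<close> with the moments \<open>m(n) = \<langle>y, T^n y\<rangle>\<close>, which
  satisfy \<open>m(n)' = - n m(n + 1)\<close>.  Its derivative of order \<open>n \<ge> 1\<close> is consequently
  \<open>- (- 1)^n n! (m(n) - \<alpha> m(n + 1))\<close>.  As \<open>T\<close> is symmetric, the two quadratic forms at \<open>x\<^sub>k\<close> are also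
  multiples of such differences, namely \<open>(k!)\<^sup>2 (m(n) - \<alpha> m(n + 1))\<close> with \<open>n = 2 k\<close> for
  \<open>K\<^sup>* K + \<alpha> B\<close> and \<open>n = 2 k + 1\<close> for \<open>B\<close> (\<open>energy_sol\<close>, \<open>penalty_sol\<close>).  Comparing the factors
  gives the constant \<open>C\<^sub>k = - (2 k)! / (k!)\<^sup>2\<close>, which solves the recursion.
\<close>

section \<open>Iterated derivatives\<close>

text \<open>The curve \<open>f\<close> is only known on an open set, so the total operator \<open>vector_derivative\<close> has to be
  compared with the chain \<open>g\<close> of true derivatives one order at a time on the whole set.\<close>

lemma higher_vector_derivative_eq:
  assumes "open S" and f: "\<And>t. t \<in> S \<Longrightarrow> f t = g 0 t"
    and g: "\<And>n t. t \<in> S \<Longrightarrow> (g n has_vector_derivative g (Suc n) t) (at t)"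
    and "t \<in> S"
  shows "higher_vector_derivative n f t = g n t"
  using \<open>t \<in> S\<close>
proof (induction n arbitrary: t)
  case 0
  then show ?case by (simp add: higher_vector_derivative_def f)
next
  case (Suc n)
  have "(higher_vector_derivative n f has_vector_derivative g (Suc n) t) (at t)"
    using has_vector_derivative_transform_within_open[OF g[OF Suc.prems, of n] \<open>open S\<close> Suc.prems]
      Suc.IH by (metis (no_types, lifting))
  then have "vector_derivative (higher_vector_derivative n f) (at t) = g (Suc n) t"
    by (rule vector_derivative_at)
  then show ?case by (simp add: higher_vector_derivative_def)
qed

lemma iterated_deriv_eq_higher_vector_derivative:
  "(deriv ^^ n) f = higher_vector_derivative n (f :: real \<Rightarrow> real)"
proof (induction n)
  case 0
  then show ?case by (simp add: higher_vector_derivative_def)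
next
  case (Suc n)
  have "deriv h = (\<lambda>t. vector_derivative h (at t))" for h :: "real \<Rightarrow> real"
    by (simp add: fun_eq_iff field_derivative_eq_vector_derivative)
  then show ?case using Suc by (simp add: higher_vector_derivative_def)
qed

text \<open>Mere continuity of \<open>w\<close> at \<open>a\<close> suffices because the other factor vanishes there; the product
  rule would ask for a derivative of \<open>w\<close>, which is not available where this is applied.\<close>

lemma has_vector_derivative_linear_factor:
  fixes w :: "real \<Rightarrow> 'a::real_normed_vector"
  assumes "(w \<longlongrightarrow> w a) (at a)"
  shows "((\<lambda>b. (b - a) *\<^sub>R w b) has_vector_derivative w a) (at a)"
proof -
  have "((\<lambda>b. w b - w a) \<longlongrightarrow> 0) (at a)"
    using assms by (simp add: LIM_zero)
  then have "((\<lambda>b. (1 / norm (b - a)) *\<^sub>R ((b - a) *\<^sub>R w b - ((a - a) *\<^sub>R w a + (b - a) *\<^sub>R w a)))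
      \<longlongrightarrow> 0) (at a)"
  proof (rule Lim_null_comparison[rotated, OF tendsto_norm_zero])
    show "\<forall>\<^sub>F b in at a. norm ((1 / norm (b - a)) *\<^sub>R
        ((b - a) *\<^sub>R w b - ((a - a) *\<^sub>R w a + (b - a) *\<^sub>R w a))) \<le> norm (w b - w a)"
      by (rule always_eventually) (simp flip: scaleR_diff_right)
  qed
  then show ?thesis
    unfolding has_vector_derivative_def has_derivative_at_within
    by (simp add: bounded_linear_scaleR_left inverse_eq_divide)
qed

section \<open>The closed graph theorem\<close>

lemma norm_diff_le_geometric:
  fixes u :: "nat \<Rightarrow> 'a::real_normed_vector"
  assumes "\<And>n. norm (u (Suc n) - u n) \<le> c / 2 ^ n"
  shows "norm (u (n + k) - u n) \<le> 2 * c / 2 ^ n - 2 * c / 2 ^ (n + k)"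
proof (induction k)
  case (Suc k)
  have "norm (u (n + Suc k) - u n) \<le> norm (u (Suc (n + k)) - u (n + k)) + norm (u (n + k) - u n)"
    by (rule order_trans[OF _ norm_triangle_ineq]) simp
  also have "\<dots> \<le> c / 2 ^ (n + k) + (2 * c / 2 ^ n - 2 * c / 2 ^ (n + k))"
    using assms Suc by (intro add_mono) auto
  finally show ?case by (simp add: field_simps)
qed simp

text \<open>By Baire, some set \<open>L n\<close> where \<open>\<parallel>S x\<parallel> \<le> n\<close> is dense in a ball, and by convexity and symmetry
  in a ball around the origin.  So every \<open>x\<close> is approximated with error \<open>\<parallel>x\<parallel> / 2\<close> by a point \<open>h x\<close> with
  \<open>\<parallel>S (h x)\<parallel> \<le> M \<parallel>x\<parallel>\<close>.  Approximating the successive errors writes \<open>x\<close> as a series whose image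
  under \<open>S\<close> is dominated by a geometric series; the closed graph identifies its sum with \<open>S x\<close>.\<close>

lemma closed_graph_imp_bounded_linear:
  fixes S :: "'a::{real_normed_vector,complete_space} \<Rightarrow> 'b::{real_normed_vector,complete_space}"
  assumes lin: "linear S"
    and graph: "\<And>u x y. u \<longlonglongrightarrow> x \<Longrightarrow> (\<lambda>n. S (u n)) \<longlonglongrightarrow> y \<Longrightarrow> S x = y"
  shows "bounded_linear S"
proof -
  define L where "L n = {x. norm (S x) \<le> real n}" for n
  have "\<exists>n. interior (closure (L n)) \<noteq> {}"
  proof (rule ccontr)
    assume "\<not> ?thesis"
    then have "euclidean interior_of \<Union>(range (\<lambda>n. closure (L n))) = {}"
      by (intro Baire_category_alt) (auto simp: completely_metrizable_space_euclidean)
    moreover have "\<Union>(range (\<lambda>n. closure (L n))) = UNIV"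
      using real_arch_simple closure_subset by (fastforce simp: L_def)
    ultimately show False by simp
  qed
  then obtain n x0 where "x0 \<in> interior (closure (L n))" by blast
  then obtain r where r: "0 < r" "ball x0 r \<subseteq> closure (L n)"
    by (meson mem_interior)
  \<comment> \<open>Halving the difference of points near \<open>x0 + x\<close> and \<open>x0 - x\<close> moves the center to the origin.\<close>
  have approx_ball: "\<exists>w. norm (S w) \<le> real n \<and> norm (x - w) < e" if "norm x < r" "0 < e" for x e
  proof -
    have "x0 + x \<in> closure (L n)" "x0 - x \<in> closure (L n)"
      using r that by (auto simp: subset_iff dist_norm)
    then obtain a b where ab: "a \<in> L n" "b \<in> L n" "norm (a - (x0 + x)) < e" "norm (b - (x0 - x)) < e"
      using \<open>0 < e\<close> unfolding closure_approachable dist_norm by blast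
    define w where "w = (1/2) *\<^sub>R (a - b)"
    have "S w = (1/2) *\<^sub>R (S a - S b)"
      unfolding w_def using lin by (simp add: linear_cmul linear_diff)
    moreover have "norm (S a - S b) \<le> 2 * real n"
      using ab norm_triangle_ineq4[of "S a" "S b"] by (simp add: L_def)
    moreover have "x - w = (1/2) *\<^sub>R ((b - (x0 - x)) - (a - (x0 + x)))"
      unfolding w_def by (simp add: algebra_simps flip: scaleR_left_distrib)
    moreover have "norm ((b - (x0 - x)) - (a - (x0 + x))) < 2 * e"
      using ab norm_triangle_ineq4[of "b - (x0 - x)" "a - (x0 + x)"] by linarith
    ultimately show ?thesis by (intro exI[of _ w]) auto
  qed
  define M where "M = 2 * real n / r"
  have "M \<ge> 0" using r by (simp add: M_def)
  have "\<exists>w. norm (S w) \<le> M * norm x \<and> norm (x - w) \<le> norm x / 2" for x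
  proof (cases "x = 0")
    case True
    then show ?thesis using lin by (intro exI[of _ 0]) (simp add: linear_0)
  next
    case False
    define s where "s = r / (2 * norm x)"
    have s: "s > 0" "s * norm x = r / 2" using r False by (auto simp: s_def)
    obtain w where w: "norm (S w) \<le> real n" "norm (s *\<^sub>R x - w) < r / 4"
      using approx_ball[of "s *\<^sub>R x" "r / 4"] s r by auto
    have "norm (S ((1/s) *\<^sub>R w)) = norm (S w) / s"
      using lin s by (simp add: linear_cmul)
    also have "\<dots> \<le> real n / s" using w s by (simp add: divide_right_mono)
    also have "\<dots> = M * norm x" using r False by (simp add: s_def M_def)
    finally have 1: "norm (S ((1/s) *\<^sub>R w)) \<le> M * norm x" .
    have "x - (1/s) *\<^sub>R w = (1/s) *\<^sub>R (s *\<^sub>R x - w)" using s by (simp add: algebra_simps)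
    then have "norm (x - (1/s) *\<^sub>R w) = norm (s *\<^sub>R x - w) / s" using s by simp
    also have "\<dots> \<le> (r / 4) / s" using w s by (intro divide_right_mono) auto
    also have "\<dots> = norm x / 2" using r False by (simp add: s_def)
    finally show ?thesis using 1 by blast
  qed
  then obtain h where h: "\<And>x. norm (S (h x)) \<le> M * norm x" "\<And>x. norm (x - h x) \<le> norm x / 2"
    by metis
  have "norm (S x) \<le> norm x * (2 * M)" for x
  proof -
    \<comment> \<open>The error left after \<open>m\<close> approximation steps.\<close>
    define e where "e = rec_nat x (\<lambda>_ z. z - h z)"
    have e: "e 0 = x" "e (Suc m) = e m - h (e m)" for m by (auto simp: e_def)
    have e_le: "norm (e m) \<le> norm x / 2 ^ m" for m
    proof (induction m)
      case (Suc m)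
      then show ?case using h(2)[of "e m"] by (simp add: e)
    qed (simp add: e)
    define u where "u m = S (x - e m)" for m
    have step: "norm (u (Suc m) - u m) \<le> (M * norm x) / 2 ^ m" for m
    proof -
      have "u (Suc m) - u m = S (h (e m))"
        using lin by (simp add: u_def e flip: linear_diff)
      then have "norm (u (Suc m) - u m) \<le> M * norm (e m)" using h(1) by simp
      also have "\<dots> \<le> M * (norm x / 2 ^ m)" using e_le \<open>M \<ge> 0\<close> by (rule mult_left_mono)
      finally show ?thesis by simp
    qed
    define c where "c = M * norm x"
    have "c \<ge> 0" using \<open>M \<ge> 0\<close> by (simp add: c_def)
    have diff: "norm (u (m + k) - u m) \<le> 2 * c / 2 ^ m" for m k
      using norm_diff_le_geometric[of u c m k] step \<open>c \<ge> 0\<close>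
      by (smt (verit, best) c_def divide_nonneg_nonneg zero_le_power)
    have pow0: "(\<lambda>m. a / 2 ^ m) \<longlonglongrightarrow> 0" for a :: real
      by (rule LIMSEQ_divide_realpow_zero) simp
    have "Cauchy u"
    proof (rule CauchyI')
      fix d :: real assume "d > 0"
      then obtain m0 where m0: "\<And>m. m \<ge> m0 \<Longrightarrow> 2 * c / 2 ^ m < d"
        using order_tendstoD(2)[OF pow0] unfolding eventually_sequentially by metis
      have "norm (u m - u k) < d" if "m \<ge> m0" "k > m" for m k
        using diff[of m "k - m"] m0[of m] that by (simp add: norm_minus_commute)
      then show "\<exists>m0. \<forall>m\<ge>m0. \<forall>k>m. dist (u m) (u k) < d"
        unfolding dist_norm by blast
    qed
    then obtain y where y: "u \<longlonglongrightarrow> y" using Cauchy_convergent_iff convergent_def by metis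
    have "u 0 = 0" using lin by (simp add: u_def e linear_0)
    then have "norm (u m) \<le> 2 * c" for m using diff[of 0 m] by simp
    then have "norm y \<le> 2 * c"
      by (intro LIMSEQ_le_const2[OF tendsto_norm[OF y]]) auto
    have "e \<longlonglongrightarrow> 0"
      by (rule Lim_null_comparison[OF always_eventually pow0]) (use e_le in auto)
    then have "(\<lambda>m. x - e m) \<longlonglongrightarrow> x" using tendsto_diff[OF tendsto_const] by fastforce
    then have "S x = y" using y by (intro graph) (auto simp: u_def[abs_def])
    then show ?thesis using \<open>norm y \<le> 2 * c\<close> by (simp add: c_def algebra_simps)
  qed
  then show ?thesis
    using lin by (intro bounded_linear_intro[where K = "2 * M"]) (auto simp: linear_add linear_cmul)
qed

section \<open>Adjoints on Hilbert spaces\<close>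

lemma nonneg_quadratic_imp_linear_coeff_zero:
  fixes b c :: real
  assumes "\<And>t. 0 \<le> 2 * t * b + t\<^sup>2 * c"
  shows "b = 0"
proof (rule ccontr)
  assume "b \<noteq> 0"
  \<comment> \<open>The minimizer \<open>t = - b / c\<close> of the quadratic, with \<open>c\<close> enlarged so that it is positive.\<close>
  define d where "d = \<bar>c\<bar> + 1"
  have d: "d > 0" "c < 2 * d" by (auto simp: d_def)
  have "2 * (- b / d) * b + (- b / d)\<^sup>2 * c = (b\<^sup>2 / d\<^sup>2) * (c - 2 * d)"
    using d by (simp add: field_simps power2_eq_square)
  moreover have "(b\<^sup>2 / d\<^sup>2) * (c - 2 * d) < 0"
    using d \<open>b \<noteq> 0\<close> by (intro mult_pos_neg) auto
  ultimately show False using assms[of "- b / d"] by simp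
qed

text \<open>The representing vector is the minimizer of \<open>\<parallel>x\<parallel>\<^sup>2 - 2 \<phi> x\<close>, whose Euler equation is
  \<open>\<langle>z, v\<rangle> = \<phi> v\<close>.  Minimizing sequences are Cauchy by the parallelogram identity.\<close>

lemma riesz_representation:
  fixes \<phi> :: "'a::{real_inner,complete_space} \<Rightarrow> real"
  assumes "bounded_linear \<phi>"
  obtains z where "\<And>v. \<phi> v = z \<bullet> v"
proof -
  interpret \<phi>: bounded_linear \<phi> by fact
  define J where "J x = x \<bullet> x - 2 * \<phi> x" for x
  obtain c where c: "\<And>x. norm (\<phi> x) \<le> norm x * c"
    using \<phi>.bounded by blast
  have "- c\<^sup>2 \<le> J x" for x
  proof -
    have "0 \<le> (norm x - c)\<^sup>2" by simp
    then show ?thesis using c[of x]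
      by (simp add: J_def power2_diff algebra_simps flip: power2_norm_eq_inner)
  qed
  then have bdd: "bdd_below (range J)" by (intro bdd_belowI2)
  define m where "m = Inf (range J)"
  have m_le: "m \<le> J x" for x unfolding m_def using bdd by (auto intro: cInf_lower)
  define \<epsilon> where "\<epsilon> n = inverse (real (Suc n))" for n
  have "\<epsilon> n > 0" for n by (simp add: \<epsilon>_def)
  then have "\<exists>x. J x < m + \<epsilon> n" for n
    using cInf_lessD[of "range J" "m + \<epsilon> n"] by (auto simp: m_def)
  then obtain u where u: "\<And>n. J (u n) < m + \<epsilon> n" by metis
  have par: "(norm (x - y))\<^sup>2 \<le> 2 * (J x - m) + 2 * (J y - m)" for x y
  proof -
    have "(norm (x - y))\<^sup>2 = 2 * J x + 2 * J y - 4 * J ((1/2) *\<^sub>R (x + y))"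
      unfolding power2_norm_eq_inner J_def
      by (simp add: \<phi>.scaleR \<phi>.add inner_simps inner_commute algebra_simps)
    then show ?thesis using m_le[of "(1/2) *\<^sub>R (x + y)"] by simp
  qed
  have "Cauchy u"
  proof (rule CauchyI')
    fix e :: real assume "e > 0"
    then have "0 < e\<^sup>2 / 4" by simp
    then obtain N where N: "\<epsilon> N < e\<^sup>2 / 4"
      unfolding \<epsilon>_def using reals_Archimedean by metis
    have "norm (u i - u k) < e" if "i \<ge> N" "k > i" for i k
    proof -
      have "\<epsilon> i \<le> \<epsilon> N" "\<epsilon> k \<le> \<epsilon> N"
        using that by (auto simp: \<epsilon>_def field_simps)
      then have "(norm (u i - u k))\<^sup>2 < e\<^sup>2"
        using par[of "u i" "u k"] u[of i] u[of k] N by argo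
      then show ?thesis using \<open>e > 0\<close> by (simp add: power_less_imp_less_base)
    qed
    then show "\<exists>N. \<forall>i\<ge>N. \<forall>k>i. dist (u i) (u k) < e"
      unfolding dist_norm by blast
  qed
  then obtain z where z: "u \<longlonglongrightarrow> z" using Cauchy_convergent_iff convergent_def by metis
  have "(\<lambda>n. J (u n)) \<longlonglongrightarrow> J z"
    unfolding J_def
    by (rule tendsto_diff[OF tendsto_inner[OF z z] tendsto_mult[OF tendsto_const \<phi>.tendsto[OF z]]])
  moreover have "(\<lambda>n. m + \<epsilon> n) \<longlonglongrightarrow> m + 0"
    unfolding \<epsilon>_def by (rule tendsto_add[OF tendsto_const LIMSEQ_inverse_real_of_nat])
  ultimately have "J z \<le> m + 0"
    by (rule LIMSEQ_le) (use u in \<open>auto intro: less_imp_le\<close>)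
  have "z \<bullet> v - \<phi> v = 0" for v
  proof (rule nonneg_quadratic_imp_linear_coeff_zero)
    fix t :: real
    have "J (z + t *\<^sub>R v) = J z + (2 * t * (z \<bullet> v - \<phi> v) + t\<^sup>2 * (v \<bullet> v))"
      by (simp add: J_def \<phi>.add \<phi>.scaleR inner_simps inner_commute power2_eq_square algebra_simps)
    then show "0 \<le> 2 * t * (z \<bullet> v - \<phi> v) + t\<^sup>2 * (v \<bullet> v)"
      using m_le[of "z + t *\<^sub>R v"] \<open>J z \<le> m + 0\<close> by linarith
  qed
  then show ?thesis by (intro that[of z]) simp
qed

text \<open>\<open>adjoint\<close> is defined by a choice operator, so its characteristic property rests on the existence
  of an adjoint map, which the Riesz representation provides.\<close>

lemma inner_adjoint_right:
  fixes T :: "'a::{real_inner,complete_space} \<Rightarrow> 'b::real_inner"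
  assumes "bounded_linear T"
  shows "x \<bullet> adjoint T y = T x \<bullet> y"
proof -
  have "\<exists>z. \<forall>x. T x \<bullet> y = x \<bullet> z" for y
  proof -
    have "bounded_linear (\<lambda>x. T x \<bullet> y)"
      using assms bounded_linear_inner_left bounded_linear_compose by blast
    then obtain z where "\<And>x. T x \<bullet> y = z \<bullet> x"
      using riesz_representation by blast
    then show ?thesis by (auto simp: inner_commute)
  qed
  then obtain T' where "\<And>x y. T x \<bullet> y = x \<bullet> T' y" by metis
  then show ?thesis using adjoint_unique[of T T'] by simp
qed

section \<open>The regularized normal equation\<close>

text \<open>The equation \<open>(K\<^sup>* K + \<alpha> B) x = K\<^sup>* y\<close> is stated weakly, tested against every \<open>v\<close>, which avoids the
  adjoint of \<open>K\<close>.  Solvability is assumed only for right-hand sides in the range of that adjoint, so that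
  the operator on the left need not be onto: take \<open>K = 0\<close> and \<open>B\<close> injective with a proper
  dense range.\<close>

locale regularized_equation =
  fixes K :: "'x::{real_inner,complete_space} \<Rightarrow> 'y::{real_inner,complete_space}"
    and B :: "'x \<Rightarrow> 'x"
  assumes K: "bounded_linear K" and B: "bounded_linear B"
    and B_sym: "\<And>x v. B x \<bullet> v = x \<bullet> B v"
    and B_nonneg: "\<And>x. 0 \<le> B x \<bullet> x"
    and unique_solution:
      "\<And>\<alpha> y. 0 < \<alpha> \<Longrightarrow> \<exists>!x. \<forall>v. K x \<bullet> K v + \<alpha> * (B x \<bullet> v) = y \<bullet> K v"
begin

interpretation K: bounded_linear K by (rule K)
interpretation B: bounded_linear B by (rule B)

definition sol :: "real \<Rightarrow> 'y \<Rightarrow> 'x" where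
  "sol \<alpha> y = (THE x. \<forall>v. K x \<bullet> K v + \<alpha> * (B x \<bullet> v) = y \<bullet> K v)"

text \<open>Formally \<open>res \<alpha>\<close> is the resolvent \<open>(\<alpha> + K B\<^sup>-\<^sup>1 K\<^sup>*)\<^sup>-\<^sup>1\<close>: it obeys the resolvent identity even when
  \<open>B\<close> is not invertible.\<close>

definition res :: "real \<Rightarrow> 'y \<Rightarrow> 'y" where
  "res \<alpha> y = (1 / \<alpha>) *\<^sub>R (y - K (sol \<alpha> y))"

context
  fixes \<alpha> :: real
  assumes \<alpha>: "0 < \<alpha>"
begin

lemma sol_eq: "K (sol \<alpha> y) \<bullet> K v + \<alpha> * (B (sol \<alpha> y) \<bullet> v) = y \<bullet> K v"
  using theI'[OF unique_solution[OF \<alpha>, of y]] unfolding sol_def by blast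

lemma sol_unique:
  assumes "\<And>v. K x \<bullet> K v + \<alpha> * (B x \<bullet> v) = y \<bullet> K v"
  shows "sol \<alpha> y = x"
  using unique_solution[OF \<alpha>, of y] assms sol_eq[of y] by blast

lemma K_sol: "K (sol \<alpha> y) = y - \<alpha> *\<^sub>R res \<alpha> y"
  using \<alpha> by (simp add: res_def)

text \<open>The image of a solution under \<open>B\<close> is again an admissible right-hand side; this is what
  makes differentiation in \<open>\<alpha>\<close> stay within solvable equations.\<close>

lemma B_sol: "B (sol \<alpha> y) \<bullet> v = res \<alpha> y \<bullet> K v"
  using sol_eq[of y v] \<alpha> by (simp add: res_def inner_simps field_simps)

lemma K_sol_sym: "K (sol \<alpha> y) \<bullet> z = y \<bullet> K (sol \<alpha> z)"
  using sol_eq[of y "sol \<alpha> z"] sol_eq[of z "sol \<alpha> y"] B_sym[of "sol \<alpha> y" "sol \<alpha> z"]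
  by (simp add: inner_commute)

lemma res_sym: "res \<alpha> y \<bullet> z = y \<bullet> res \<alpha> z"
  using K_sol_sym[of y z] by (simp add: res_def inner_simps)

lemma linear_sol: "linear (sol \<alpha>)"
proof (rule linearI; rule sol_unique)
  fix y z v
  show "K (sol \<alpha> y + sol \<alpha> z) \<bullet> K v + \<alpha> * (B (sol \<alpha> y + sol \<alpha> z) \<bullet> v) = (y + z) \<bullet> K v"
    using sol_eq[of y v] sol_eq[of z v] by (simp add: K.add B.add inner_simps algebra_simps)
next
  fix r y v
  have "r * (K (sol \<alpha> y) \<bullet> K v + \<alpha> * (B (sol \<alpha> y) \<bullet> v)) = r * (y \<bullet> K v)"
    by (simp add: sol_eq)
  then show "K (r *\<^sub>R sol \<alpha> y) \<bullet> K v + \<alpha> * (B (r *\<^sub>R sol \<alpha> y) \<bullet> v) = (r *\<^sub>R y) \<bullet> K v"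
    by (simp add: K.scaleR B.scaleR algebra_simps)
qed

text \<open>The weak equation passes to the limit on both sides, so the graph of \<open>sol \<alpha>\<close> is closed.\<close>

lemma bounded_linear_sol: "bounded_linear (sol \<alpha>)"
proof (rule closed_graph_imp_bounded_linear[OF linear_sol])
  fix u y x
  assume u: "u \<longlonglongrightarrow> y" "(\<lambda>n. sol \<alpha> (u n)) \<longlonglongrightarrow> x"
  show "sol \<alpha> y = x"
  proof (rule sol_unique)
    fix v
    have "(\<lambda>n. K (sol \<alpha> (u n)) \<bullet> K v + \<alpha> * (B (sol \<alpha> (u n)) \<bullet> v))
        \<longlonglongrightarrow> K x \<bullet> K v + \<alpha> * (B x \<bullet> v)"
      by (intro tendsto_intros K.tendsto B.tendsto u)
    moreover have "(\<lambda>n. u n \<bullet> K v) \<longlonglongrightarrow> y \<bullet> K v" by (intro tendsto_intros u)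
    ultimately show "K x \<bullet> K v + \<alpha> * (B x \<bullet> v) = y \<bullet> K v"
      unfolding sol_eq by (rule LIMSEQ_unique)
  qed
qed

lemma bounded_linear_res: "bounded_linear (res \<alpha>)"
  unfolding res_def
  by (rule bounded_linear_compose[OF bounded_linear_scaleR_right bounded_linear_sub[OF
        bounded_linear_ident bounded_linear_compose[OF K bounded_linear_sol]]])

text \<open>Testing the equation with its own solution shows \<open>\<parallel>K x\<parallel>\<^sup>2 \<le> \<langle>y, K x\<rangle>\<close>, so the residual \<open>y - K x\<close> is
  no longer than \<open>y\<close>.  The bound is locally uniform in \<open>\<alpha>\<close>, as the continuity argument below needs.\<close>

lemma norm_res_le: "norm (res \<alpha> y) \<le> norm y / \<alpha>"
proof -
  let ?x = "sol \<alpha> y"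
  have "K ?x \<bullet> K ?x \<le> y \<bullet> K ?x"
    using sol_eq[of y ?x] mult_nonneg_nonneg[OF less_imp_le[OF \<alpha>] B_nonneg[of ?x]] by linarith
  then have "(y - K ?x) \<bullet> (y - K ?x) \<le> y \<bullet> y"
    using inner_ge_zero[of "K ?x"] inner_commute[of "K ?x" y]
    unfolding inner_diff_left inner_diff_right by linarith
  then have "norm (y - K ?x) \<le> norm y" by (simp add: norm_le)
  then show ?thesis using \<alpha> by (simp add: res_def divide_right_mono)
qed

text \<open>Moving the surplus \<open>(\<beta> - \<alpha>) B x\<close> of the equation for \<open>\<beta>\<close> to the right-hand side gives an
  equation for \<open>\<alpha>\<close>, by \<open>B_sol\<close>.\<close>

lemma sol_resolvent:
  assumes \<beta>: "0 < \<beta>"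
  shows "sol \<beta> y = sol \<alpha> (y - (\<beta> - \<alpha>) *\<^sub>R res \<beta> y)"
proof (rule sol_unique[symmetric])
  fix v
  have "y \<bullet> K v = K (sol \<beta> y) \<bullet> K v + \<beta> * (B (sol \<beta> y) \<bullet> v)"
    using regularized_equation.sol_eq[OF regularized_equation_axioms \<beta>] by simp
  moreover have "B (sol \<beta> y) \<bullet> v = res \<beta> y \<bullet> K v"
    using regularized_equation.B_sol[OF regularized_equation_axioms \<beta>] by simp
  ultimately show "K (sol \<beta> y) \<bullet> K v + \<alpha> * (B (sol \<beta> y) \<bullet> v)
      = (y - (\<beta> - \<alpha>) *\<^sub>R res \<beta> y) \<bullet> K v"
    by (simp add: inner_simps algebra_simps)
qed

lemma res_resolvent:
  assumes \<beta>: "0 < \<beta>"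
  shows "res \<beta> y = res \<alpha> (y - (\<beta> - \<alpha>) *\<^sub>R res \<beta> y)"
proof -
  have "K (sol \<beta> y) = y - \<beta> *\<^sub>R res \<beta> y"
    using regularized_equation.K_sol[OF regularized_equation_axioms \<beta>] .
  then have "y - (\<beta> - \<alpha>) *\<^sub>R res \<beta> y - K (sol \<beta> y) = \<alpha> *\<^sub>R res \<beta> y"
    by (simp add: algebra_simps)
  then show ?thesis
    using \<alpha> unfolding res_def[of \<alpha>] sol_resolvent[OF \<beta>, symmetric] by simp
qed

lemma res_power_inner: "(res \<alpha> ^^ m) y \<bullet> (res \<alpha> ^^ n) z = y \<bullet> (res \<alpha> ^^ (m + n)) z"
proof (induction m arbitrary: n)
  case (Suc m)
  have "(res \<alpha> ^^ Suc m) y \<bullet> (res \<alpha> ^^ n) z = (res \<alpha> ^^ m) y \<bullet> (res \<alpha> ^^ Suc n) z"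
    by (simp add: res_sym)
  then show ?case using Suc[of "Suc n"] by simp
qed simp

lemma tendsto_res:
  assumes u: "(u \<longlongrightarrow> u \<alpha>) (at \<alpha>)"
  shows "((\<lambda>\<beta>. res \<beta> (u \<beta>)) \<longlongrightarrow> res \<alpha> (u \<alpha>)) (at \<alpha>)"
proof -
  have ev: "\<forall>\<^sub>F \<beta> in at \<alpha>. 0 < \<beta>"
    using \<alpha> by (intro order_tendstoD(1)[OF tendsto_ident_at])
  have "((\<lambda>\<beta>. \<bar>\<beta> - \<alpha>\<bar> * (norm (u \<beta>) / \<beta>)) \<longlongrightarrow> \<bar>\<alpha> - \<alpha>\<bar> * (norm (u \<alpha>) / \<alpha>)) (at \<alpha>)"
    using \<alpha> by (intro tendsto_intros u) auto
  then have "((\<lambda>\<beta>. \<bar>\<beta> - \<alpha>\<bar> * (norm (u \<beta>) / \<beta>)) \<longlongrightarrow> 0) (at \<alpha>)"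
    by simp
  then have "((\<lambda>\<beta>. (\<beta> - \<alpha>) *\<^sub>R res \<beta> (u \<beta>)) \<longlongrightarrow> 0) (at \<alpha>)"
  proof (rule Lim_null_comparison[rotated])
    show "\<forall>\<^sub>F \<beta> in at \<alpha>. norm ((\<beta> - \<alpha>) *\<^sub>R res \<beta> (u \<beta>)) \<le> \<bar>\<beta> - \<alpha>\<bar> * (norm (u \<beta>) / \<beta>)"
      using ev
    proof (rule eventually_mono)
      fix \<beta> :: real assume "0 < \<beta>"
      then have "norm (res \<beta> (u \<beta>)) \<le> norm (u \<beta>) / \<beta>"
        by (rule regularized_equation.norm_res_le[OF regularized_equation_axioms])
      then show "norm ((\<beta> - \<alpha>) *\<^sub>R res \<beta> (u \<beta>)) \<le> \<bar>\<beta> - \<alpha>\<bar> * (norm (u \<beta>) / \<beta>)"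
        unfolding norm_scaleR real_norm_def by (rule mult_left_mono) simp
    qed
  qed
  then have "((\<lambda>\<beta>. u \<beta> - (\<beta> - \<alpha>) *\<^sub>R res \<beta> (u \<beta>)) \<longlongrightarrow> u \<alpha> - 0) (at \<alpha>)"
    by (intro tendsto_diff u)
  then have "((\<lambda>\<beta>. res \<alpha> (u \<beta> - (\<beta> - \<alpha>) *\<^sub>R res \<beta> (u \<beta>))) \<longlongrightarrow> res \<alpha> (u \<alpha>)) (at \<alpha>)"
    using bounded_linear.tendsto[OF bounded_linear_res] by fastforce
  then show ?thesis
    by (rule Lim_transform_eventually) (rule eventually_mono[OF ev res_resolvent[symmetric]])
qed

text \<open>A common product rule for \<open>G = res\<close> and \<open>G = sol\<close>.  The resolvent identity concentrates the
  dependence on \<open>\<beta>\<close> in the argument of the fixed operator \<open>G \<alpha>\<close>, so no differentiation of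
  operator-valued maps is involved.\<close>

lemma resolvent_family_derivative:
  assumes u: "(u has_vector_derivative u') (at \<alpha>)"
    and G: "bounded_linear (G \<alpha>)"
    and G_res: "\<And>\<beta> y. 0 < \<beta> \<Longrightarrow> G \<beta> y = G \<alpha> (y - (\<beta> - \<alpha>) *\<^sub>R res \<beta> y)"
  shows "((\<lambda>\<beta>. G \<beta> (u \<beta>)) has_vector_derivative G \<alpha> (u' - res \<alpha> (u \<alpha>))) (at \<alpha>)"
proof -
  have "(u \<longlongrightarrow> u \<alpha>) (at \<alpha>)"
    using has_vector_derivative_continuous[OF u] by (simp add: continuous_at)
  then have "((\<lambda>\<beta>. u \<beta> - (\<beta> - \<alpha>) *\<^sub>R res \<beta> (u \<beta>)) has_vector_derivative (u' - res \<alpha> (u \<alpha>))) (at \<alpha>)"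
    by (intro has_vector_derivative_diff u has_vector_derivative_linear_factor tendsto_res)
  then have "((\<lambda>\<beta>. G \<alpha> (u \<beta> - (\<beta> - \<alpha>) *\<^sub>R res \<beta> (u \<beta>))) has_vector_derivative
      G \<alpha> (u' - res \<alpha> (u \<alpha>))) (at \<alpha>)"
    by (rule bounded_linear.has_vector_derivative[OF G])
  then show ?thesis
    by (rule has_vector_derivative_transform_within_open[where S = "{0<..}"])
      (simp_all add: \<alpha> G_res[symmetric])
qed

lemma res_power_derivative:
  "((\<lambda>\<beta>. (res \<beta> ^^ n) y) has_vector_derivative - real n *\<^sub>R (res \<alpha> ^^ Suc n) y) (at \<alpha>)"
proof (induction n)
  case (Suc n)
  interpret res: bounded_linear "res \<alpha>" by (rule bounded_linear_res)
  show ?case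
    using resolvent_family_derivative[where G = res, OF Suc bounded_linear_res res_resolvent]
    by (simp add: res.scaleR res.diff res.neg algebra_simps minus_diff_commute)
qed simp

lemma sol_res_power_derivative:
  "((\<lambda>\<beta>. sol \<beta> ((res \<beta> ^^ n) y)) has_vector_derivative
     - real (Suc n) *\<^sub>R sol \<alpha> ((res \<alpha> ^^ Suc n) y)) (at \<alpha>)"
proof -
  interpret sol: bounded_linear "sol \<alpha>" by (rule bounded_linear_sol)
  show ?thesis
    using resolvent_family_derivative[where G = sol,
        OF res_power_derivative[of n y] bounded_linear_sol sol_resolvent]
    by (simp add: sol.scaleR sol.diff sol.neg algebra_simps minus_diff_commute)
qed

end

lemma higher_derivative_sol:
  assumes "0 < \<alpha>" and "\<And>\<beta>. 0 < \<beta> \<Longrightarrow> f \<beta> = sol \<beta> y"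
  shows "higher_vector_derivative k f \<alpha>
    = ((- 1) ^ k * fact k) *\<^sub>R sol \<alpha> ((res \<alpha> ^^ k) y)"
proof (rule higher_vector_derivative_eq[where S = "{0<..}"
      and g = "\<lambda>k \<alpha>. ((- 1) ^ k * fact k) *\<^sub>R sol \<alpha> ((res \<alpha> ^^ k) y)"])
  fix n t assume "t \<in> {0::real<..}"
  then show "((\<lambda>\<alpha>. ((- 1) ^ n * fact n) *\<^sub>R sol \<alpha> ((res \<alpha> ^^ n) y)) has_vector_derivative
      ((- 1) ^ Suc n * fact (Suc n)) *\<^sub>R sol t ((res t ^^ Suc n) y)) (at t)"
    using bounded_linear.has_vector_derivative[OF bounded_linear_scaleR_right
        sol_res_power_derivative[of t n y], of "(- 1) ^ n * fact n"]
    by (simp add: algebra_simps)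
qed (use assms in auto)

definition moment :: "'y \<Rightarrow> nat \<Rightarrow> real \<Rightarrow> real" where
  "moment y n \<alpha> = y \<bullet> (res \<alpha> ^^ n) y"

lemma moment_derivative:
  assumes "0 < \<alpha>"
  shows "(moment y n has_vector_derivative - real n * moment y (Suc n) \<alpha>) (at \<alpha>)"
  using bounded_linear.has_vector_derivative[OF bounded_linear_inner_right
      res_power_derivative[OF assms, of n y], of y]
  unfolding moment_def by simp

text \<open>For \<open>n = 0\<close> the term \<open>y \<bullet> y\<close> cancels the moment of order \<open>0\<close>, which leaves
  \<open>\<alpha> * moment y 1 \<alpha>\<close>, the minimal value.  Being constant in \<open>\<alpha>\<close>, it disappears from the derivatives,
  so that one formula serves all orders.\<close>

definition value_derivative :: "'y \<Rightarrow> nat \<Rightarrow> real \<Rightarrow> real" where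
  "value_derivative y n \<alpha> = (if n = 0 then y \<bullet> y else 0)
     + (- 1) ^ n * fact n * (\<alpha> * moment y (Suc n) \<alpha> - moment y n \<alpha>)"

lemma value_derivative_derivative:
  assumes "0 < \<alpha>"
  shows "(value_derivative y n has_vector_derivative value_derivative y (Suc n) \<alpha>) (at \<alpha>)"
proof -
  note [derivative_intros] = moment_derivative[OF assms,
      folded has_real_derivative_iff_has_vector_derivative]
  show ?thesis
    unfolding value_derivative_def has_real_derivative_iff_has_vector_derivative[symmetric]
    by (rule derivative_eq_intros refl)+ (simp add: algebra_simps)
qed

text \<open>The equation turns the energy of a solution into \<open>\<langle>p, K (sol \<alpha> p)\<rangle> = \<langle>p, p - \<alpha> res \<alpha> p\<rangle>\<close> with
  \<open>p\<close> the \<open>k\<close>-th iterate of \<open>res \<alpha>\<close>, and symmetry collects all iterates on one side.  The penalty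
  differs by one more factor \<open>res \<alpha>\<close>, which raises the order of the moments by one.\<close>

lemma energy_sol:
  assumes "0 < \<alpha>"
  shows "K (sol \<alpha> ((res \<alpha> ^^ k) y)) \<bullet> K (sol \<alpha> ((res \<alpha> ^^ k) y))
      + \<alpha> * (B (sol \<alpha> ((res \<alpha> ^^ k) y)) \<bullet> sol \<alpha> ((res \<alpha> ^^ k) y))
    = moment y (2 * k) \<alpha> - \<alpha> * moment y (Suc (2 * k)) \<alpha>"
  unfolding sol_eq[OF assms] unfolding K_sol[OF assms]
  using res_power_inner[OF assms, of k y k y] res_power_inner[OF assms, of k y "Suc k" y]
  by (simp add: moment_def inner_simps mult_2)

lemma penalty_sol:
  assumes "0 < \<alpha>"
  shows "B (sol \<alpha> ((res \<alpha> ^^ k) y)) \<bullet> sol \<alpha> ((res \<alpha> ^^ k) y)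
    = moment y (Suc (2 * k)) \<alpha> - \<alpha> * moment y (Suc (Suc (2 * k))) \<alpha>"
  unfolding B_sol[OF assms] unfolding K_sol[OF assms]
  using res_power_inner[OF assms, of "Suc k" y k y] res_power_inner[OF assms, of "Suc k" y "Suc k" y]
  by (simp add: moment_def inner_simps mult_2)

end

section \<open>The minimal value\<close>

lemma tikhonov_add_scaleR:
  assumes "bounded_linear K" and "bounded_linear B" and "\<And>x v. B x \<bullet> v = x \<bullet> B v"
  shows "tikhonov K B y \<alpha> (x + t *\<^sub>R v) = tikhonov K B y \<alpha> x
    + (2 * t * (K x \<bullet> K v + \<alpha> * (B x \<bullet> v) - y \<bullet> K v) + t\<^sup>2 * ((norm (K v))\<^sup>2 + \<alpha> * (B v \<bullet> v)))"
proof -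
  interpret K: bounded_linear K by fact
  interpret B: bounded_linear B by fact
  have "B v \<bullet> x = B x \<bullet> v" using assms(3)[of v x] by (simp add: inner_commute)
  then show ?thesis
    unfolding tikhonov_def power2_norm_eq_inner
    by (simp add: K.add K.scaleR B.add B.scaleR inner_simps inner_commute power2_eq_square algebra_simps)
qed

lemma is_arg_min_tikhonov_iff:
  assumes "bounded_linear K" and "bounded_linear B" and "\<And>x v. B x \<bullet> v = x \<bullet> B v"
    and "\<And>x. 0 \<le> B x \<bullet> x" and "0 < \<alpha>"
  shows "is_arg_min (tikhonov K B y \<alpha>) (\<lambda>_. True) x
    \<longleftrightarrow> (\<forall>v. K x \<bullet> K v + \<alpha> * (B x \<bullet> v) = y \<bullet> K v)"
proof
  assume min: "is_arg_min (tikhonov K B y \<alpha>) (\<lambda>_. True) x"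
  show "\<forall>v. K x \<bullet> K v + \<alpha> * (B x \<bullet> v) = y \<bullet> K v"
  proof
    fix v
    have "K x \<bullet> K v + \<alpha> * (B x \<bullet> v) - y \<bullet> K v = 0"
    proof (rule nonneg_quadratic_imp_linear_coeff_zero)
      fix t
      show "0 \<le> 2 * t * (K x \<bullet> K v + \<alpha> * (B x \<bullet> v) - y \<bullet> K v)
          + t\<^sup>2 * ((norm (K v))\<^sup>2 + \<alpha> * (B v \<bullet> v))"
        using min tikhonov_add_scaleR[OF assms(1-3), of y \<alpha> x t v]
        by (smt (verit) is_arg_min_linorder)
    qed
    then show "K x \<bullet> K v + \<alpha> * (B x \<bullet> v) = y \<bullet> K v" by simp
  qed
next
  assume eq: "\<forall>v. K x \<bullet> K v + \<alpha> * (B x \<bullet> v) = y \<bullet> K v"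
  have "tikhonov K B y \<alpha> x \<le> tikhonov K B y \<alpha> z" for z
  proof -
    have "0 \<le> (norm (K (z - x)))\<^sup>2 + \<alpha> * (B (z - x) \<bullet> (z - x))" using assms(4,5) by simp
    then show ?thesis using tikhonov_add_scaleR[OF assms(1-3), of y \<alpha> x 1 "z - x"] eq by simp
  qed
  then show "is_arg_min (tikhonov K B y \<alpha>) (\<lambda>_. True) x" by (simp add: is_arg_min_linorder)
qed

text \<open>The denominator comes from the factors \<open>k!\<close> of the two copies of \<open>x\<^sub>k\<close>, the numerator from
  the derivative of order \<open>2 k\<close> of the value.\<close>

lemma C_eq_neg_central_binomial:
  assumes "1 \<le> k"
  shows "C k = - fact (2 * k) / (fact k)\<^sup>2"
  using assms
proof (induction k rule: dec_induct)
  case (step k)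
  then obtain j where j: "k = Suc j" by (cases k) auto
  have "C (Suc k) = 2 * (2 * real k + 1) / (real k + 1) * C k" by (simp add: j)
  also have "\<dots> = - fact (2 * Suc k) / (fact (Suc k))\<^sup>2"
    unfolding step.IH by (simp add: divide_simps power2_eq_square) (simp add: algebra_simps)
  finally show ?case .
qed (simp add: numeral_2_eq_2)

theorem theorem2:
  fixes K :: "'x::{real_inner,complete_space} \<Rightarrow> 'y::{real_inner,complete_space}"
    and B :: "'x \<Rightarrow> 'x"
    and y\<delta> :: 'y
  assumes "bounded_linear K"
    and "bounded_linear B"
    and "adjoint B = B"
    and "\<And>x. 0 \<le> B x \<bullet> x"
    and "\<And>\<alpha> y. 0 < \<alpha> \<Longrightarrow> \<exists>!x. is_arg_min (tikhonov K B y \<alpha>) (\<lambda>_. True) x"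
  shows "(\<forall>\<alpha>>0. \<forall>n. ((deriv ^^ n) (value_fun K B y\<delta>)) differentiable (at \<alpha>)) \<and>
    (\<forall>\<alpha>>0. \<forall>k\<ge>1.
      let xk = higher_vector_derivative k (tikhonov_min K B y\<delta>) \<alpha> in
        (deriv ^^ (2 * k)) (value_fun K B y\<delta>) \<alpha>
          = C k * ((adjoint K (K xk) + \<alpha> *\<^sub>R B xk) \<bullet> xk) \<and>
        (deriv ^^ (2 * k + 1)) (value_fun K B y\<delta>) \<alpha>
          = - C k * (1 + 2 * real k) * (B xk \<bullet> xk))"
proof -
  \<comment> \<open>The hypothesis \<open>adjoint B = B\<close> yields symmetry only because \<open>B\<close> has an adjoint at all.\<close>
  have sym: "B x \<bullet> v = x \<bullet> B v" for x v
    using inner_adjoint_right[OF assms(2)] assms(3) by metis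
  note min_iff = is_arg_min_tikhonov_iff[OF assms(1,2) sym assms(4)]
  interpret regularized_equation K B
  proof (rule regularized_equation.intro)
    fix \<alpha> :: real and y assume "0 < \<alpha>"
    then show "\<exists>!x. \<forall>v. K x \<bullet> K v + \<alpha> * (B x \<bullet> v) = y \<bullet> K v"
      using assms(5)[of \<alpha> y] by (simp add: min_iff)
  qed (fact assms(1,2,4) sym)+
  interpret B: bounded_linear B by fact
  interpret K: bounded_linear K by fact
  have sol_min: "is_arg_min (tikhonov K B y\<delta> \<alpha>) (\<lambda>_. True) (sol \<alpha> y\<delta>)" if "0 < \<alpha>" for \<alpha>
    using that by (simp add: min_iff sol_eq)
  have min_eq: "tikhonov_min K B y\<delta> \<alpha> = sol \<alpha> y\<delta>" if "0 < \<alpha>" for \<alpha>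
    unfolding tikhonov_min_def arg_min_def using sol_min[OF that] assms(5)[OF that]
    by (metis someI_ex)
  have value_eq: "value_fun K B y\<delta> \<alpha> = value_derivative y\<delta> 0 \<alpha>" if "0 < \<alpha>" for \<alpha>
  proof -
    let ?x = "sol \<alpha> y\<delta>"
    have "value_fun K B y\<delta> \<alpha> = tikhonov K B y\<delta> \<alpha> ?x"
      unfolding value_fun_def
      by (rule cInf_eq_minimum) (use sol_min[OF that] in \<open>auto simp: is_arg_min_linorder\<close>)
    also have "\<dots> = y\<delta> \<bullet> y\<delta> - y\<delta> \<bullet> K ?x"
      using sol_eq[OF that, of y\<delta> ?x]
      by (simp add: tikhonov_def power2_norm_eq_inner inner_simps inner_commute)
    also have "\<dots> = value_derivative y\<delta> 0 \<alpha>"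
      by (simp add: value_derivative_def moment_def K_sol[OF that] inner_simps)
    finally show ?thesis .
  qed
  have deriv_eq: "(deriv ^^ n) (value_fun K B y\<delta>) \<alpha> = value_derivative y\<delta> n \<alpha>" if "0 < \<alpha>" for n \<alpha>
    unfolding iterated_deriv_eq_higher_vector_derivative
    by (rule higher_vector_derivative_eq[where S = "{0<..}"])
      (use that value_eq value_derivative_derivative in auto)
  have "(deriv ^^ n) (value_fun K B y\<delta>) differentiable (at \<alpha>)" if "0 < \<alpha>" for n \<alpha>
  proof -
    have "((deriv ^^ n) (value_fun K B y\<delta>) has_vector_derivative value_derivative y\<delta> (Suc n) \<alpha>) (at \<alpha>)"
      by (rule has_vector_derivative_transform_within_open[OF value_derivative_derivative[OF that],
            where S = "{0<..}"]) (use that deriv_eq in auto)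
    then show ?thesis by (rule differentiableI_vector)
  qed
  moreover have "(deriv ^^ (2 * k)) (value_fun K B y\<delta>) \<alpha>
          = C k * ((adjoint K (K xk) + \<alpha> *\<^sub>R B xk) \<bullet> xk)" (is ?even)
        and "(deriv ^^ (2 * k + 1)) (value_fun K B y\<delta>) \<alpha>
          = - C k * (1 + 2 * real k) * (B xk \<bullet> xk)" (is ?odd)
    if "0 < \<alpha>" "1 \<le> k" and xk: "xk = higher_vector_derivative k (tikhonov_min K B y\<delta>) \<alpha>"
    for \<alpha> k xk
  proof -
    define s where "s = sol \<alpha> ((res \<alpha> ^^ k) y\<delta>)"
    define c :: real where "c = (- 1) ^ k * fact k"
    have xk_eq: "xk = c *\<^sub>R s"
      unfolding xk s_def c_def by (rule higher_derivative_sol[OF \<open>0 < \<alpha>\<close> min_eq])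
    have "c\<^sup>2 = (fact k)\<^sup>2"
      by (simp add: c_def power_mult_distrib flip: power_mult)
    then have B_xk: "B xk \<bullet> xk = (fact k)\<^sup>2 * (B s \<bullet> s)"
      and K_xk: "K xk \<bullet> K xk = (fact k)\<^sup>2 * (K s \<bullet> K s)"
      by (simp_all add: xk_eq B.scaleR K.scaleR power2_eq_square flip: mult.assoc)
    have "adjoint K (K xk) \<bullet> xk = K xk \<bullet> K xk"
      using inner_adjoint_right[OF assms(1)] by (simp add: inner_commute)
    then have "(adjoint K (K xk) + \<alpha> *\<^sub>R B xk) \<bullet> xk = (fact k)\<^sup>2 * (K s \<bullet> K s + \<alpha> * (B s \<bullet> s))"
      by (simp add: inner_simps B_xk K_xk algebra_simps)
    also have "\<dots> = (fact k)\<^sup>2 * (moment y\<delta> (2 * k) \<alpha> - \<alpha> * moment y\<delta> (Suc (2 * k)) \<alpha>)"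
      unfolding s_def energy_sol[OF \<open>0 < \<alpha>\<close>] ..
    finally show ?even
      unfolding deriv_eq[OF \<open>0 < \<alpha>\<close>] value_derivative_def C_eq_neg_central_binomial[OF \<open>1 \<le> k\<close>]
      using \<open>1 \<le> k\<close> by (simp add: right_diff_distrib)
    define E where "E = moment y\<delta> (Suc (2 * k)) \<alpha> - \<alpha> * moment y\<delta> (Suc (Suc (2 * k))) \<alpha>"
    have "B xk \<bullet> xk = (fact k)\<^sup>2 * E"
      unfolding B_xk s_def E_def penalty_sol[OF \<open>0 < \<alpha>\<close>] ..
    then have "- C k * (1 + 2 * real k) * (B xk \<bullet> xk) = fact (2 * k) * (1 + 2 * real k) * E"
      by (simp add: C_eq_neg_central_binomial[OF \<open>1 \<le> k\<close>])
    also have "\<dots> = value_derivative y\<delta> (2 * k + 1) \<alpha>"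
      by (simp add: value_derivative_def E_def algebra_simps)
    finally show ?odd unfolding deriv_eq[OF \<open>0 < \<alpha>\<close>] by simp
  qed
  ultimately show ?thesis by (simp add: Let_def)
qed

end
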